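(* Let $E_n$ be the number of labeled non-plane 1-2 trees on vertex set $[n]$, and let $A_{0,n}$ be the total number of leaves in all such trees. Then \[\lim_{n\to\infty}\frac{A_{0,n}}{nE_n}=1-\frac{2}{\pi}\approx 0.3633802278.\]
   Context: A labeled non-plane 1-2 tree on vertex set $[n]=\{1,\dots,n\}$ is a rooted tree whose vertices are bijectively labeled by $[n]$, in which every vertex has at most two children, the label of each non-root vertex is less than the label of its parent, and the children of a vertex are unordered. A leaf is a vertex with no children. The number $E_n$ of such trees is the $n$th Euler number, with $\sum_{n\ge0}E_n z^n/n!=\sec z+\tan z$ ($E_0=1$). *)

theory Defs
  imports Complex_Main
begin

text \<open>
  A rooted tree on the vertex set \<open>V\<close> is given by its root \<open>r\<close> and the set \<open>P\<close> of its
  (child, parent) pairs. Being a set of pairs, \<open>P\<close> carries no order on the children of a vertex.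
\<close>

definition rooted_tree :: "'a set \<Rightarrow> 'a \<Rightarrow> ('a \<times> 'a) set \<Rightarrow> bool" where
  "rooted_tree V r P \<longleftrightarrow>
     r \<in> V \<and> P \<subseteq> V \<times> V \<and>
     (\<forall>u. (r, u) \<notin> P) \<and>
     (\<forall>v\<in>V - {r}. \<exists>!u. (v, u) \<in> P) \<and>
     (\<forall>v\<in>V. (v, r) \<in> P\<^sup>*)"

definition children :: "('a \<times> 'a) set \<Rightarrow> 'a \<Rightarrow> 'a set" where
  "children P v = {c. (c, v) \<in> P}"

definition leaves :: "'a set \<Rightarrow> ('a \<times> 'a) set \<Rightarrow> 'a set" where
  "leaves V P = {v \<in> V. children P v = {}}"

text \<open>The vertices are identified with their labels.\<close>

definition trees12 :: "nat \<Rightarrow> (nat \<times> (nat \<times> nat) set) set" where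
  "trees12 n = {(r, P). rooted_tree {1..n} r P \<and>
                        (\<forall>v\<in>{1..n}. card (children P v) \<le> 2) \<and>
                        (\<forall>(c, p)\<in>P. c < p)}"

text \<open>A rooted tree has at least one vertex, so the value at \<open>0\<close> is set by convention.\<close>

definition euler_number :: "nat \<Rightarrow> nat" where
  "euler_number n = (if n = 0 then 1 else card (trees12 n))"

definition total_leaves :: "nat \<Rightarrow> nat" where
  "total_leaves n = (\<Sum>(r, P)\<in>trees12 n. card (leaves {1..n} P))"

lemma finite_trees12: "finite (trees12 n)"
proof (rule finite_subset)
  show "trees12 n \<subseteq> {1..n} \<times> Pow ({1..n} \<times> {1..n})"
    by (auto simp: trees12_def rooted_tree_def)
qed auto

end

theory Submission
  imports Defs "HOL-Complex_Analysis.Complex_Analysis"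
begin

text \<open>
  The smallest vertex of a tree is a leaf, and removing it leaves a smaller tree together with a
  marked vertex having fewer than two children. A tree on \<open>n\<close> vertices with \<open>l\<close> leaves has
  \<open>n + 1 - l\<close> such vertices, so \<open>A\<^sub>0\<^sub>,\<^sub>n = (n + 1) E\<^sub>n - E\<^sub>n\<^sub>+\<^sub>1\<close>.

  Give leaves the weight \<open>y'\<close> and vertices with one child the weight \<open>y\<close>, where \<open>y = sec + tan\<close>
  satisfies \<open>y' = (1 + y\<^sup>2) / 2\<close> and hence \<open>y'' = y' y\<close>. Differentiating the weight of a tree sums
  over all ways of attaching a new smallest vertex, so the trees on \<open>n\<close> vertices have
  total weight equal to the \<open>n\<close>-th derivative of \<open>y\<close>; at \<open>0\<close> all weights are \<open>1\<close>.
  The function \<open>(\<pi>/2 - z) y(z)\<close> is holomorphic beyond \<open>\<pi>/2\<close>, and the partial sums of its power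
  series there telescope to \<open>E\<^sub>n / n! (\<pi>/2)\<^sup>n\<^sup>+\<^sup>1\<close>, which therefore converges to a nonzero limit.
  Thus \<open>E\<^sub>n\<^sub>+\<^sub>1 / ((n + 1) E\<^sub>n)\<close> tends to \<open>2 / \<pi>\<close>.
\<close>

section \<open>Combinatorics of decreasing trees\<close>

text \<open>Only the edges are recorded: the root is necessarily \<open>N\<close>. The lower end \<open>m\<close> of the vertex set
  varies so that the smallest vertex can be removed without relabelling.\<close>

definition dtrees :: "nat \<Rightarrow> nat \<Rightarrow> (nat \<times> nat) set set" where
  "dtrees m N = {P. P \<subseteq> {m..N} \<times> {m..N} \<and> (\<forall>(c, p)\<in>P. c < p) \<and>
                    (\<forall>c\<in>{m..<N}. \<exists>!p. (c, p) \<in> P) \<and>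
                    (\<forall>v\<in>{m..N}. card (children P v) \<le> 2)}"

definition open_vertices :: "nat \<Rightarrow> nat \<Rightarrow> (nat \<times> nat) set \<Rightarrow> nat set" where
  "open_vertices m N P = {v \<in> {m..N}. card (children P v) < 2}"

definition vertex_weight :: "'a \<Rightarrow> 'a \<Rightarrow> nat \<Rightarrow> 'a :: comm_semiring_1" where
  "vertex_weight a b k = (if k = 0 then a else if k = 1 then b else 1)"

definition tree_weight :: "'a \<Rightarrow> 'a \<Rightarrow> nat \<Rightarrow> nat \<Rightarrow> (nat \<times> nat) set \<Rightarrow> 'a :: comm_semiring_1" where
  "tree_weight a b m N P = (\<Prod>v\<in>{m..N}. vertex_weight a b (card (children P v)))"

lemma vertex_weight_1_1 [simp]: "vertex_weight 1 1 k = 1"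
  by (simp add: vertex_weight_def)

lemma finite_dtrees: "finite (dtrees m N)"
  by (rule finite_subset[of _ "Pow ({m..N} \<times> {m..N})"]) (auto simp: dtrees_def)

lemma finite_open_vertices: "finite (open_vertices m N P)"
  by (simp add: open_vertices_def)

lemma finite_children:
  assumes "P \<in> dtrees m N"
  shows "finite (children P v)"
  by (rule finite_subset[of _ "{m..N}"]) (use assms in \<open>auto simp: dtrees_def children_def\<close>)

text \<open>Passing to a parent strictly increases the label, so an ascending path can only stop at
  \<open>N\<close>. Connectivity is thus automatic for decreasing trees.\<close>

lemma increasing_imp_reaches_top:
  fixes m N :: nat
  assumes "\<forall>(c, p)\<in>P. c < p" "P \<subseteq> {m..N} \<times> {m..N}" "\<forall>c\<in>{m..<N}. \<exists>p. (c, p) \<in> P"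
    and "v \<in> {m..N}"
  shows "(v, N) \<in> P\<^sup>*"
  using assms(4)
proof (induction "N - v" arbitrary: v rule: less_induct)
  case less
  show ?case
  proof (cases "v = N")
    case False
    then have "v \<in> {m..<N}" using less.prems by auto
    then obtain p where p: "(v, p) \<in> P" using assms(3) by blast
    then have "v < p" "p \<in> {m..N}" using assms(1,2) by auto
    then have "(p, N) \<in> P\<^sup>*" using less.hyps[of p] by auto
    then show ?thesis using p by (meson converse_rtrancl_into_rtrancl)
  qed auto
qed

text \<open>The label \<open>n\<close> cannot have a larger parent, so it is the root and the edge
  set determines the tree.\<close>

lemma trees12_eq_dtrees:
  assumes "n \<ge> 1"
  shows "trees12 n = Pair n ` dtrees 1 n"
proof (intro equalityI subsetI)
  fix t assume "t \<in> trees12 n"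
  then obtain r P where t: "t = (r, P)" and tree: "rooted_tree {1..n} r P"
    and ch: "\<forall>v\<in>{1..n}. card (children P v) \<le> 2" and inc: "\<forall>(c, p)\<in>P. c < p"
    by (auto simp: trees12_def)
  have sub: "P \<subseteq> {1..n} \<times> {1..n}" and un: "\<forall>v\<in>{1..n} - {r}. \<exists>!u. (v, u) \<in> P"
    using tree by (auto simp: rooted_tree_def)
  have "r = n"
  proof (rule ccontr)
    assume "r \<noteq> n"
    then have "n \<in> {1..n} - {r}" using assms by auto
    then obtain u where u: "(n, u) \<in> P" using un by blast
    then have "n < u" "u \<le> n" using inc sub by auto
    then show False by simp
  qed
  moreover have "\<forall>c\<in>{1..<n}. \<exists>!p. (c, p) \<in> P"
    using un \<open>r = n\<close> by auto
  ultimately show "t \<in> Pair n ` dtrees 1 n"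
    using t sub ch inc by (auto simp: dtrees_def)
next
  fix t assume "t \<in> Pair n ` dtrees 1 n"
  then obtain P where t: "t = (n, P)" and P: "P \<in> dtrees 1 n" by auto
  have sub: "P \<subseteq> {1..n} \<times> {1..n}" and inc: "\<forall>(c, p)\<in>P. c < p"
    and un: "\<forall>c\<in>{1..<n}. \<exists>!p. (c, p) \<in> P" and ch: "\<forall>v\<in>{1..n}. card (children P v) \<le> 2"
    using P unfolding dtrees_def by auto
  have "(n, u) \<notin> P" for u
    using sub inc by fastforce
  moreover have "(v, n) \<in> P\<^sup>*" if "v \<in> {1..n}" for v
    using increasing_imp_reaches_top[OF inc sub _ that] un by blast
  moreover have "\<forall>v\<in>{1..n} - {n}. \<exists>!u. (v, u) \<in> P"
    using un by auto
  ultimately have "rooted_tree {1..n} n P"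
    using assms sub unfolding rooted_tree_def by auto
  then show "t \<in> trees12 n"
    using t ch inc by (auto simp: trees12_def)
qed

section \<open>Attaching and removing the smallest vertex\<close>

lemma children_insert:
  "children (insert (c, p) P) v = (if v = p then insert c (children P v) else children P v)"
  by (auto simp: children_def)

text \<open>Since \<open>m < N\<close>, the vertex \<open>m\<close> has exactly one parent
  \<open>v\<close>, and being smallest it has no children. Deleting the edge \<open>(m, v)\<close>
  leaves \<open>v\<close> with at most one child, and the deletion is undone by reattaching
  \<open>m\<close> at \<open>v\<close>.\<close>

lemma bij_betw_attach_min:
  assumes "m < N"
  shows "bij_betw (\<lambda>(P, v). insert (m, v) P)
           (SIGMA P:dtrees (Suc m) N. open_vertices (Suc m) N P) (dtrees m N)"
    (is "bij_betw ?f ?A _")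
proof (rule bij_betw_imageI)
  have no_m: "(m, u) \<notin> P" if "P \<in> dtrees (Suc m) N" for P u
    using that by (auto simp: dtrees_def)
  show "inj_on ?f ?A"
  proof (rule inj_onI, clarify)
    fix P v Q w
    assume P: "P \<in> dtrees (Suc m) N" and Q: "Q \<in> dtrees (Suc m) N"
      and eq: "insert (m, v) P = insert (m, w) Q"
    have "v = w" using eq no_m[OF Q] by (metis insertCI insertE prod.inject)
    moreover have "P = Q"
      using eq no_m[OF P] no_m[OF Q] \<open>v = w\<close> by (metis insert_ident)
    ultimately show "P = Q \<and> v = w" by simp
  qed
  show "?f ` ?A = dtrees m N"
  proof (intro equalityI subsetI)
    fix T assume "T \<in> ?f ` ?A"
    then obtain P v where T: "T = insert (m, v) P" and P: "P \<in> dtrees (Suc m) N"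
      and v: "v \<in> {Suc m..N}" "card (children P v) < 2"
      by (auto simp: open_vertices_def)
    have sub: "P \<subseteq> {Suc m..N} \<times> {Suc m..N}" and inc: "\<forall>(c, p)\<in>P. c < p"
      and un: "\<And>c. c \<in> {Suc m..<N} \<Longrightarrow> \<exists>!p. (c, p) \<in> P"
      and ch: "\<And>u. u \<in> {Suc m..N} \<Longrightarrow> card (children P u) \<le> 2"
      using P by (auto simp: dtrees_def)
    have "\<exists>!p. (c, p) \<in> T" if c: "c \<in> {m..<N}" for c
    proof (cases "c = m")
      case True
      then show ?thesis using no_m[OF P] T by auto
    next
      case False
      then show ?thesis using un[of c] c T by auto
    qed
    moreover have "card (children T u) \<le> 2" if u: "u \<in> {m..N}" for u
    proof (cases "u = m")
      case True
      then have "children T u = {}" using sub T v by (auto simp: children_def)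
      then show ?thesis by simp
    next
      case False
      then have "card (children T u) \<le> (if u = v then Suc (card (children P u)) else card (children P u))"
        unfolding T children_insert by (auto intro!: card_insert_le_m1 simp: card_insert_if finite_children[OF P])
      then show ?thesis using ch[of u] v u False by (auto split: if_splits)
    qed
    moreover have "T \<subseteq> {m..N} \<times> {m..N}"
      using T sub v(1) assms by fastforce
    moreover have "\<forall>(c, p)\<in>T. c < p"
      using T inc v(1) by auto
    ultimately show "T \<in> dtrees m N"
      unfolding dtrees_def by blast
  next
    fix T assume T: "T \<in> dtrees m N"
    have sub: "T \<subseteq> {m..N} \<times> {m..N}" and inc: "\<And>c p. (c, p)\<in>T \<Longrightarrow> c < p"
      and un: "\<And>c. c \<in> {m..<N} \<Longrightarrow> \<exists>!p. (c, p) \<in> T"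
      and ch: "\<And>u. u \<in> {m..N} \<Longrightarrow> card (children T u) \<le> 2"
      using T by (auto simp: dtrees_def)
    obtain v where v: "(m, v) \<in> T" and v_unique: "\<And>u. (m, u) \<in> T \<Longrightarrow> u = v"
      using un[of m] assms by auto
    define P where "P = T - {(m, v)}"
    have TP: "T = insert (m, v) P" using v by (auto simp: P_def)
    have vN: "v \<in> {Suc m..N}" using sub v inc[OF v] by auto
    have fin: "finite (children T u)" for u
      using finite_children[OF T] .
    have chP: "children P u \<subseteq> children T u" for u
      by (auto simp: children_def P_def)
    have "children P v \<subset> children T v"
      using v by (auto simp: children_def P_def)
    then have "card (children P v) < card (children T v)"
      using fin by (rule psubset_card_mono[rotated])
    then have "card (children P v) < 2" using ch[of v] vN by auto
    moreover have "P \<in> dtrees (Suc m) N"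
      unfolding dtrees_def
    proof (intro CollectI conjI)
      show "P \<subseteq> {Suc m..N} \<times> {Suc m..N}"
      proof clarify
        fix c p assume cp: "(c, p) \<in> P"
        then have "(c, p) \<in> T" "c \<noteq> m" using v_unique by (auto simp: P_def)
        then have "c \<in> {m..N}" "p \<in> {m..N}" "c < p" "c \<noteq> m" using sub inc by auto
        then show "c \<in> {Suc m..N} \<and> p \<in> {Suc m..N}" by auto
      qed
      show "\<forall>(c, p)\<in>P. c < p" using inc by (auto simp: P_def)
      show "\<forall>c\<in>{Suc m..<N}. \<exists>!p. (c, p) \<in> P"
      proof
        fix c assume c: "c \<in> {Suc m..<N}"
        then have "\<exists>!p. (c, p) \<in> T" using un[of c] by auto
        then show "\<exists>!p. (c, p) \<in> P" using c by (auto simp: P_def)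
      qed
      show "\<forall>u\<in>{Suc m..N}. card (children P u) \<le> 2"
      proof
        fix u assume "u \<in> {Suc m..N}"
        then show "card (children P u) \<le> 2"
          using ch[of u] card_mono[OF fin chP[of u]] by auto
      qed
    qed
    ultimately show "T \<in> ?f ` ?A"
      using vN TP by (intro image_eqI[of _ _ "(P, v)"]) (auto simp: open_vertices_def)
  qed
qed

text \<open>The new leaf contributes \<open>a\<close>, its parent gains a child, and all other
  factors persist. With \<open>a\<close> the derivative of \<open>sec_plus_tan\<close>, this is one
  summand of the derivative of the weight of \<open>P\<close>.\<close>

lemma tree_weight_attach_min:
  assumes "P \<in> dtrees (Suc m) N" "v \<in> {Suc m..N}"
  shows "tree_weight a b m N (insert (m, v) P) =
    a * vertex_weight a b (Suc (card (children P v))) *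
    (\<Prod>u\<in>{Suc m..N} - {v}. vertex_weight a b (card (children P u)))"
proof -
  let ?T = "insert (m, v) P"
  have sub: "P \<subseteq> {Suc m..N} \<times> {Suc m..N}" using assms(1) by (auto simp: dtrees_def)
  have split: "{m..N} = insert m (insert v ({Suc m..N} - {v}))"
    using assms(2) by auto
  have "children ?T m = {}" "m \<notin> children P v"
    using sub assms(2) by (auto simp: children_def)
  then have c: "card (children ?T m) = 0" "card (children ?T v) = Suc (card (children P v))"
    using finite_children[OF assms(1)] by (auto simp: children_insert)
  have "tree_weight a b m N ?T =
      vertex_weight a b (card (children ?T m)) * (vertex_weight a b (card (children ?T v)) *
        (\<Prod>u\<in>{Suc m..N} - {v}. vertex_weight a b (card (children ?T u))))"
    unfolding tree_weight_def split using assms(2) by (subst prod.insert; (subst prod.insert)?) auto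
  moreover have "(\<Prod>u\<in>{Suc m..N} - {v}. vertex_weight a b (card (children ?T u))) =
      (\<Prod>u\<in>{Suc m..N} - {v}. vertex_weight a b (card (children P u)))"
    by (intro prod.cong) (auto simp: children_insert)
  ultimately show ?thesis unfolding c by (simp add: vertex_weight_def mult_ac)
qed

text \<open>Double counting: a vertex with \<open>k\<close> children contributes
  \<open>[k = 0] + [k < 2] + k\<close>, which is 2 for each of \<open>k = 0, 1, 2\<close>, and the
  child counts sum to the number of edges \<open>N - m\<close>.\<close>

lemma card_leaves_plus_open_vertices:
  assumes P: "P \<in> dtrees m N" and "m \<le> N"
  shows "card (leaves {m..N} P) + card (open_vertices m N P) = N - m + 2"
proof -
  have sub: "P \<subseteq> {m..N} \<times> {m..N}" and inc: "\<And>c p. (c, p)\<in>P \<Longrightarrow> c < p"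
    and un: "\<And>c. c \<in> {m..<N} \<Longrightarrow> \<exists>!p. (c, p) \<in> P"
    and ch: "\<And>u. u \<in> {m..N} \<Longrightarrow> card (children P u) \<le> 2"
    using P by (auto simp: dtrees_def)
  note fin = finite_children[OF P]
  \<comment> \<open>Every vertex except the root \<open>N\<close> is the child end of exactly one
    edge.\<close>
  have "bij_betw snd (SIGMA v:{m..N}. children P v) {m..<N}"
  proof (rule bij_betw_imageI)
    have lt: "c \<in> {m..<N}" if "(c, p) \<in> P" for c p
      using that sub inc by fastforce
    show "inj_on snd (SIGMA v:{m..N}. children P v)"
      using un lt by (auto simp: inj_on_def children_def)
    show "snd ` (SIGMA v:{m..N}. children P v) = {m..<N}"
    proof (intro equalityI subsetI)
      fix c assume "c \<in> {m..<N}"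
      then obtain p where "(c, p) \<in> P" using un by blast
      then show "c \<in> snd ` (SIGMA v:{m..N}. children P v)"
        using sub by (intro image_eqI[of _ _ "(p, c)"]) (auto simp: children_def)
    qed (use lt in \<open>auto simp: children_def\<close>)
  qed
  then have "card (SIGMA v:{m..N}. children P v) = N - m"
    by (simp add: bij_betw_same_card)
  then have edges: "(\<Sum>v\<in>{m..N}. card (children P v)) = N - m"
    using fin by simp
  have "card (leaves {m..N} P) = (\<Sum>v\<in>{m..N}. of_bool (card (children P v) = 0))"
    using fin by (simp add: leaves_def Int_def conj_commute)
  moreover have "card (open_vertices m N P) = (\<Sum>v\<in>{m..N}. of_bool (card (children P v) < 2))"
    by (simp add: open_vertices_def Int_def conj_commute)
  ultimately have "card (leaves {m..N} P) + card (open_vertices m N P) + (N - m) =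
      (\<Sum>v\<in>{m..N}. of_bool (card (children P v) = 0) + of_bool (card (children P v) < 2)
         + card (children P v))"
    unfolding edges[symmetric] by (simp add: sum.distrib)
  also have "\<dots> = (\<Sum>v\<in>{m..N}. 2)"
    by (intro sum.cong refl) (use ch in \<open>force simp: of_bool_def le_Suc_eq numeral_2_eq_2\<close>)
  also have "\<dots> = 2 * (N - m) + 2"
    using \<open>m \<le> N\<close> by (simp add: Suc_diff_le)
  finally show ?thesis by simp
qed

section \<open>Trees as derivatives of the tangent\<close>

text \<open>The half-angle form of \<open>sec z + tan z\<close>; it also covers \<open>z = -\<pi>/2\<close>, where \<open>sec\<close> and \<open>tan\<close>
  separately have poles.\<close>

definition sec_plus_tan :: "complex \<Rightarrow> complex" where
  "sec_plus_tan z = tan (z / 2 + pi / 4)"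

definition regular_points :: "complex set" where
  "regular_points = {z. cos (z / 2 + pi / 4) \<noteq> 0}"

abbreviation sec_plus_tan' :: "complex \<Rightarrow> complex" where
  "sec_plus_tan' z \<equiv> (1 + sec_plus_tan z ^ 2) / 2"

lemma open_regular_points: "open regular_points"
  unfolding regular_points_def by (intro open_Collect_neq continuous_intros) auto

lemma zero_regular: "0 \<in> regular_points"
proof -
  have "cos (complex_of_real (pi / 4)) \<noteq> 0"
    unfolding cos_of_real by (simp add: cos_45)
  then show ?thesis by (simp add: regular_points_def)
qed

lemma sec_plus_tan_0 [simp]: "sec_plus_tan 0 = 1"
proof -
  have "tan (complex_of_real (pi / 4)) = 1"
    unfolding tan_of_real[symmetric] tan_45 by (rule of_real_1)
  then show ?thesis by (simp add: sec_plus_tan_def)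
qed

text \<open>The half angle supplies the factor 1/2, and \<open>1 + tan^2 = 1 / cos^2\<close> does
  the rest.\<close>

lemma has_field_derivative_sec_plus_tan:
  assumes "z \<in> regular_points"
  shows "(sec_plus_tan has_field_derivative sec_plus_tan' z) (at z)"
proof -
  have nz: "cos (z / 2 + pi / 4) \<noteq> 0" using assms by (simp add: regular_points_def)
  have "inverse (cos (z / 2 + pi / 4) ^ 2) = 1 + sec_plus_tan z ^ 2"
    using tan_sec[OF nz] by (simp add: sec_plus_tan_def power_inverse)
  moreover have "(sec_plus_tan has_field_derivative
      inverse (cos (z / 2 + pi / 4) ^ 2) * (1 / 2)) (at z)"
    unfolding sec_plus_tan_def[abs_def] using nz by (auto intro!: derivative_eq_intros)
  ultimately show ?thesis by simp
qed

lemma holomorphic_sec_plus_tan: "sec_plus_tan holomorphic_on regular_points"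
  using has_field_derivative_sec_plus_tan open_regular_points holomorphic_on_open by blast

text \<open>With \<open>y = sec_plus_tan\<close>, the weights \<open>y'\<close>, \<open>y\<close>,
  \<open>1\<close> have derivatives \<open>y' * y\<close>, \<open>y' * 1\<close>, \<open>0\<close>.
  Differentiation thus adds a child to the vertex, paying \<open>y'\<close> for the new leaf, and
  kills vertices that are already full.\<close>

lemma has_field_derivative_vertex_weight:
  assumes "z \<in> regular_points" "k \<le> 2"
  shows "((\<lambda>z. vertex_weight (sec_plus_tan' z) (sec_plus_tan z) k) has_field_derivative
      of_bool (k < 2) * (sec_plus_tan' z * vertex_weight (sec_plus_tan' z) (sec_plus_tan z) (Suc k))) (at z)"
proof -
  note D = has_field_derivative_sec_plus_tan[OF assms(1)]
  consider "k = 0" | "k = 1" | "k = 2" using assms(2) by linarith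
  then show ?thesis
  proof cases
    case 1
    then show ?thesis
      by (auto simp: vertex_weight_def intro!: derivative_eq_intros D)
  qed (auto simp: vertex_weight_def intro!: D)
qed

lemma has_field_derivative_tree_weight:
  assumes "z \<in> regular_points" "P \<in> dtrees m N"
  shows "((\<lambda>z. tree_weight (sec_plus_tan' z) (sec_plus_tan z) m N P) has_field_derivative
      (\<Sum>v\<in>open_vertices m N P. sec_plus_tan' z *
         vertex_weight (sec_plus_tan' z) (sec_plus_tan z) (Suc (card (children P v))) *
         (\<Prod>u\<in>{m..N} - {v}. vertex_weight (sec_plus_tan' z) (sec_plus_tan z) (card (children P u))))) (at z)"
proof -
  let ?w = "\<lambda>z. vertex_weight (sec_plus_tan' z) (sec_plus_tan z)"
  have ch: "card (children P v) \<le> 2" if "v \<in> {m..N}" for v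
    using assms(2) that by (auto simp: dtrees_def)
  have "((\<lambda>z. tree_weight (sec_plus_tan' z) (sec_plus_tan z) m N P) has_field_derivative
      (\<Sum>v\<in>{m..N}. (of_bool (card (children P v) < 2) * (sec_plus_tan' z * ?w z (Suc (card (children P v))))) *
         (\<Prod>u\<in>{m..N} - {v}. ?w z (card (children P u))))) (at z)"
    unfolding tree_weight_def
    by (intro has_field_derivative_prod has_field_derivative_vertex_weight assms ch)
  moreover have "(\<Sum>v\<in>{m..N}. (of_bool (card (children P v) < 2) * (sec_plus_tan' z * ?w z (Suc (card (children P v))))) *
         (\<Prod>u\<in>{m..N} - {v}. ?w z (card (children P u)))) =
      (\<Sum>v\<in>open_vertices m N P. sec_plus_tan' z * ?w z (Suc (card (children P v))) *
         (\<Prod>u\<in>{m..N} - {v}. ?w z (card (children P u))))"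
    by (rule sum.mono_neutral_cong_right) (auto simp: open_vertices_def)
  ultimately show ?thesis by simp
qed

lemma dtrees_single: "dtrees N N = {{}}"
proof -
  have "P = {}" if "P \<in> dtrees N N" for P
    using that by (force simp: dtrees_def)
  moreover have "{} \<in> dtrees N N" by (auto simp: dtrees_def children_def)
  ultimately show ?thesis by blast
qed

text \<open>The double sum is kept unregrouped because it serves twice: in the induction below, and
  at 0, where it counts open vertices.\<close>

lemma higher_deriv_Suc_from_trees:
  assumes eq: "\<And>z. z \<in> regular_points \<Longrightarrow> (deriv ^^ k) sec_plus_tan z =
      (\<Sum>P\<in>dtrees m N. tree_weight (sec_plus_tan' z) (sec_plus_tan z) m N P)"
    and z: "z \<in> regular_points"
  shows "(deriv ^^ Suc k) sec_plus_tan z =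
    (\<Sum>P\<in>dtrees m N. \<Sum>v\<in>open_vertices m N P. sec_plus_tan' z *
       vertex_weight (sec_plus_tan' z) (sec_plus_tan z) (Suc (card (children P v))) *
       (\<Prod>u\<in>{m..N} - {v}. vertex_weight (sec_plus_tan' z) (sec_plus_tan z) (card (children P u))))"
    (is "_ = ?D")
proof -
  have "((\<lambda>z. \<Sum>P\<in>dtrees m N. tree_weight (sec_plus_tan' z) (sec_plus_tan z) m N P)
      has_field_derivative ?D) (at z)"
    by (intro DERIV_sum has_field_derivative_tree_weight z)
  then have "((deriv ^^ k) sec_plus_tan has_field_derivative ?D) (at z)"
    by (rule has_field_derivative_transform_within_open[OF _ open_regular_points z]) (simp add: eq)
  then show ?thesis by (simp add: DERIV_imp_deriv)
qed

text \<open>Induction downwards from \<open>m = N\<close>: each new smallest vertex costs one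
  derivative. The point \<open>z\<close> stays arbitrary so that the identity can be
  differentiated.\<close>

lemma higher_deriv_sec_plus_tan:
  assumes "m \<le> N" "z \<in> regular_points"
  shows "(deriv ^^ (Suc N - m)) sec_plus_tan z =
    (\<Sum>P\<in>dtrees m N. tree_weight (sec_plus_tan' z) (sec_plus_tan z) m N P)"
  using assms
proof (induction m arbitrary: z rule: inc_induct)
  case base
  have "deriv sec_plus_tan z = sec_plus_tan' z"
    using has_field_derivative_sec_plus_tan[OF base] by (rule DERIV_imp_deriv)
  then show ?case
    by (simp add: dtrees_single tree_weight_def vertex_weight_def children_def)
next
  case (step m)
  have "Suc N - m = Suc (Suc N - Suc m)" using step.hyps by simp
  then have "(deriv ^^ (Suc N - m)) sec_plus_tan z = (deriv ^^ Suc (Suc N - Suc m)) sec_plus_tan z"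
    by simp
  also have "\<dots> = (\<Sum>P\<in>dtrees (Suc m) N. \<Sum>v\<in>open_vertices (Suc m) N P. sec_plus_tan' z *
       vertex_weight (sec_plus_tan' z) (sec_plus_tan z) (Suc (card (children P v))) *
       (\<Prod>u\<in>{Suc m..N} - {v}. vertex_weight (sec_plus_tan' z) (sec_plus_tan z) (card (children P u))))"
    using step.IH step.prems by (rule higher_deriv_Suc_from_trees)
  also have "\<dots> = (\<Sum>P\<in>dtrees (Suc m) N. \<Sum>v\<in>open_vertices (Suc m) N P.
       tree_weight (sec_plus_tan' z) (sec_plus_tan z) m N (insert (m, v) P))"
    by (intro sum.cong refl) (auto simp: tree_weight_attach_min open_vertices_def)
  also have "\<dots> = (\<Sum>(P, v)\<in>(SIGMA P:dtrees (Suc m) N. open_vertices (Suc m) N P).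
       tree_weight (sec_plus_tan' z) (sec_plus_tan z) m N (insert (m, v) P))"
    by (intro sum.Sigma finite_dtrees ballI finite_open_vertices)
  also have "\<dots> = (\<Sum>P\<in>dtrees m N. tree_weight (sec_plus_tan' z) (sec_plus_tan z) m N P)"
    using sum.reindex_bij_betw[OF bij_betw_attach_min[OF step.hyps(2)],
        of "tree_weight (sec_plus_tan' z) (sec_plus_tan z) m N"]
    by (simp add: case_prod_unfold)
  finally show ?case .
qed

section \<open>Counting trees and leaves by derivatives at 0\<close>

lemma euler_number_eq_card: "n \<ge> 1 \<Longrightarrow> euler_number n = card (dtrees 1 n)"
  by (simp add: euler_number_def trees12_eq_dtrees card_image inj_on_def)

lemma total_leaves_eq_sum: "n \<ge> 1 \<Longrightarrow> total_leaves n = (\<Sum>P\<in>dtrees 1 n. card (leaves {1..n} P))"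
  by (simp add: total_leaves_def trees12_eq_dtrees sum.reindex inj_on_def)

lemma euler_number_eq_deriv: "(deriv ^^ n) sec_plus_tan 0 = of_nat (euler_number n)"
proof (cases "n = 0")
  case False
  then have "(deriv ^^ n) sec_plus_tan 0 = (\<Sum>P\<in>dtrees 1 n. tree_weight 1 1 1 n P)"
    using higher_deriv_sec_plus_tan[of 1 n 0] zero_regular by simp
  then show ?thesis
    using False by (simp add: euler_number_eq_card tree_weight_def)
qed (simp add: euler_number_def)

text \<open>Comparing derivatives at 0, where all weights are 1, avoids relabelling the trees on
  \<open>{0..n}\<close> as trees on \<open>{1..n + 1}\<close>.\<close>

lemma euler_number_Suc:
  assumes "n \<ge> 1"
  shows "euler_number (Suc n) = (\<Sum>P\<in>dtrees 1 n. card (open_vertices 1 n P))"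
proof -
  have "(deriv ^^ Suc n) sec_plus_tan 0 =
      (\<Sum>P\<in>dtrees 1 n. \<Sum>v\<in>open_vertices 1 n P. 1)"
    using higher_deriv_Suc_from_trees[of n 1 n 0] higher_deriv_sec_plus_tan[of 1 n] zero_regular assms
    by simp
  then have "(of_nat (euler_number (Suc n)) :: complex) =
      of_nat (\<Sum>P\<in>dtrees 1 n. card (open_vertices 1 n P))"
    unfolding euler_number_eq_deriv by simp
  then show ?thesis by (simp only: of_nat_eq_iff)
qed

lemma total_leaves_plus_euler_number_Suc:
  assumes "n \<ge> 1"
  shows "total_leaves n + euler_number (Suc n) = (n + 1) * euler_number n"
proof -
  have "total_leaves n + euler_number (Suc n) =
      (\<Sum>P\<in>dtrees 1 n. card (leaves {1..n} P) + card (open_vertices 1 n P))"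
    by (simp only: total_leaves_eq_sum[OF assms] euler_number_Suc[OF assms] sum.distrib)
  also have "\<dots> = (\<Sum>P\<in>dtrees 1 n. n + 1)"
    by (intro sum.cong refl) (use card_leaves_plus_open_vertices[of _ 1 n] assms in auto)
  finally show ?thesis using assms by (simp add: euler_number_eq_card)
qed

section \<open>Asymptotics of the Euler numbers\<close>

text \<open>Leibniz rule with a linear factor, whose second derivative vanishes. For
  \<open>n = 0\<close> the truncated \<open>n - 1\<close> is harmless, as its coefficient is
  0.\<close>

lemma higher_deriv_linear_mult:
  assumes "f holomorphic_on S" "open S" "z \<in> S"
  shows "(deriv ^^ n) (\<lambda>z. (c - z) * f z) z =
    (c - z) * (deriv ^^ n) f z - of_nat n * (deriv ^^ (n - 1)) f z"
  using assms(3)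
proof (induction n arbitrary: z)
  case (Suc n)
  have D: "((deriv ^^ k) f has_field_derivative (deriv ^^ Suc k) f z) (at z)" for k
    using holomorphic_derivI[OF holomorphic_higher_deriv[OF assms(1,2)] assms(2) Suc.prems] by simp
  have "((\<lambda>z. (c - z) * (deriv ^^ n) f z - of_nat n * (deriv ^^ (n - 1)) f z) has_field_derivative
      (c - z) * (deriv ^^ Suc n) f z - (deriv ^^ n) f z - of_nat n * (deriv ^^ Suc (n - 1)) f z) (at z)"
    by (rule derivative_eq_intros D refl | simp)+
  then have "((deriv ^^ n) (\<lambda>z. (c - z) * f z) has_field_derivative
      (c - z) * (deriv ^^ Suc n) f z - (deriv ^^ n) f z - of_nat n * (deriv ^^ Suc (n - 1)) f z) (at z)"
    by (rule has_field_derivative_transform_within_open[OF _ assms(2) Suc.prems]) (simp add: Suc.IH)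
  then show ?case by (cases n) (simp_all add: DERIV_imp_deriv algebra_simps)
qed simp

text \<open>With \<open>u = (pi/2 - z) / 2\<close> one has \<open>sec_plus_tan z = cot u\<close>, so
  the product is \<open>2 * u * cot u = 2 * cos u / sinc u\<close>. The zeros of \<open>sinc\<close>
  satisfy \<open>|u| >= pi\<close>, whereas \<open>|z| < 2\<close> gives
  \<open>|u| < pi/4 + 1 < pi\<close>.\<close>

lemma pole_removed_sec_plus_tan:
  obtains g where "g holomorphic_on ball 0 2" "g (of_real pi / 2) = 2"
    "\<And>z. z \<in> ball 0 2 \<inter> regular_points \<Longrightarrow> g z = (of_real pi / 2 - z) * sec_plus_tan z"
proof -
  define sinc :: "complex \<Rightarrow> complex" where "sinc u = (if u = 0 then 1 else sin u / u)" for u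
  have "deriv sin (0::complex) = 1"
    by (rule DERIV_imp_deriv) (auto intro!: derivative_eq_intros)
  then have hol: "sinc holomorphic_on UNIV"
    by (intro pole_theorem_open_0[of sin UNIV 0 sinc])
      (simp_all add: sinc_def holomorphic_on_sin)
  define g :: "complex \<Rightarrow> complex" where
    "g z = 2 * cos ((of_real pi / 2 - z) / 2) / sinc ((of_real pi / 2 - z) / 2)" for z
  have nz: "sinc ((of_real pi / 2 - z) / 2) \<noteq> 0" if "z \<in> ball 0 2" for z :: complex
  proof
    define u where "u = (of_real pi / 2 - z) / 2"
    assume "sinc ((of_real pi / 2 - z) / 2) = 0"
    then have "u \<noteq> 0" "sin u = 0" by (auto simp: sinc_def u_def split: if_splits)
    then obtain k :: int where k: "u = of_real (k * pi)" by (auto simp: sin_eq_0)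
    with \<open>u \<noteq> 0\<close> have "\<bar>real_of_int k\<bar> \<ge> 1" by (cases "k = 0") auto
    then have "norm u \<ge> pi"
      unfolding k norm_of_real by (simp add: abs_mult)
    moreover have "norm u \<le> (norm (complex_of_real pi / 2) + norm z) / 2"
      unfolding u_def norm_divide using norm_triangle_ineq4[of "complex_of_real pi / 2" z] by simp
    then have "norm u \<le> (pi / 2 + norm z) / 2" by simp
    ultimately show False using that pi_gt3 by simp
  qed
  show ?thesis
  proof
    have "(\<lambda>z. sinc ((of_real pi / 2 - z) / 2)) holomorphic_on ball 0 2"
      by (rule holomorphic_on_compose_gen[OF _ hol, unfolded o_def]) (auto intro!: holomorphic_intros)
    then show "g holomorphic_on ball 0 2"
      unfolding g_def[abs_def] using nz by (auto intro!: holomorphic_intros)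
    show "g (of_real pi / 2) = 2" by (simp add: g_def sinc_def)
    fix z assume z: "z \<in> ball 0 2 \<inter> regular_points"
    define u where "u = (of_real pi / 2 - z) / 2"
    \<comment> \<open>The shift turns \<open>cos\<close> into \<open>sin u\<close>, so regularity of
      \<open>z\<close> means that \<open>sin u\<close> is nonzero.\<close>
    have e: "z / 2 + of_real (pi / 4) = complex_of_real pi / 2 - u"
      by (simp add: u_def field_simps)
    have "sin u \<noteq> 0"
      using z unfolding regular_points_def mem_Collect_eq Int_iff e
      by (simp add: cos_diff)
    then have "u \<noteq> 0" by auto
    have "sec_plus_tan z = cos u / sin u"
      unfolding sec_plus_tan_def e by (simp add: tan_def sin_diff cos_diff)
    moreover have "of_real pi / 2 - z = 2 * u" by (simp add: u_def)
    moreover have "g z = 2 * cos u / (sin u / u)"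
      using \<open>u \<noteq> 0\<close> by (simp add: g_def sinc_def u_def)
    ultimately show "g z = (of_real pi / 2 - z) * sec_plus_tan z"
      by simp
  qed
qed

text \<open>The exponent \<open>Suc n\<close> makes this exactly the \<open>n\<close>-th partial
  sum, at \<open>pi/2\<close>, of the power series of the function with its pole removed.\<close>

definition scaled_euler :: "nat \<Rightarrow> real" where
  "scaled_euler n = euler_number n / fact n * (pi / 2) ^ Suc n"

lemma scaled_euler_tendsto: "scaled_euler \<longlonglongrightarrow> 2"
proof -
  obtain g where hol: "g holomorphic_on ball 0 2" and g2: "g (of_real pi / 2) = 2"
    and g: "\<And>z. z \<in> ball 0 2 \<inter> regular_points \<Longrightarrow> g z = (of_real pi / 2 - z) * sec_plus_tan z"
    using pole_removed_sec_plus_tan by blast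
  let ?S = "ball 0 2 \<inter> regular_points"
  have S: "open ?S" "0 \<in> ?S" using open_regular_points zero_regular by auto
  have holy: "sec_plus_tan holomorphic_on ?S"
    by (rule holomorphic_on_subset[OF holomorphic_sec_plus_tan]) auto
  have dg: "(deriv ^^ n) g 0 = of_real pi / 2 * of_nat (euler_number n) - of_nat n * of_nat (euler_number (n - 1))" for n
  proof -
    have "(deriv ^^ n) g 0 = (deriv ^^ n) (\<lambda>z. (of_real pi / 2 - z) * sec_plus_tan z) 0"
      by (rule higher_deriv_transform_within_open[OF _ _ S(1,2)])
        (use g in \<open>auto intro!: holomorphic_intros holy holomorphic_on_subset[OF hol]\<close>)
    also have "\<dots> = (of_real pi / 2 - 0) * (deriv ^^ n) sec_plus_tan 0 - of_nat n * (deriv ^^ (n - 1)) sec_plus_tan 0"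
      by (rule higher_deriv_linear_mult[OF holy S])
    finally show ?thesis by (simp add: euler_number_eq_deriv)
  qed
  have partial: "(\<Sum>k\<le>n. (deriv ^^ k) g 0 / fact k * (of_real pi / 2) ^ k) = of_real (scaled_euler n)" for n
  proof (induction n)
    case 0
    then show ?case using dg[of 0] by (simp add: scaled_euler_def)
  next
    case (Suc n)
    \<comment> \<open>The two terms of \<open>dg\<close> become consecutive values of
      \<open>scaled_euler\<close>, so the sum telescopes.\<close>
    have "(deriv ^^ Suc n) g 0 / fact (Suc n) * (of_real pi / 2) ^ Suc n =
        complex_of_real (scaled_euler (Suc n)) - of_real (scaled_euler n)"
      unfolding dg scaled_euler_def by (simp add: field_simps del: of_nat_Suc)
    then show ?case using Suc by (simp only: sum.atMost_Suc) simp
  qed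
  \<comment> \<open>The point \<open>pi/2\<close> lies inside the disc of radius 2 because
    \<open>pi < 4\<close>.\<close>
  have "(\<lambda>n. (deriv ^^ n) g 0 / fact n * (complex_of_real pi / 2 - 0) ^ n) sums g (complex_of_real pi / 2)"
    using hol by (rule holomorphic_power_series) (use pi_less_4 in simp)
  then have "(\<lambda>n. \<Sum>k\<le>n. (deriv ^^ k) g 0 / fact k * (of_real pi / 2) ^ k) \<longlonglongrightarrow> 2"
    using g2 by (simp add: sums_def_le)
  then have "(\<lambda>n. complex_of_real (scaled_euler n)) \<longlonglongrightarrow> complex_of_real 2"
    unfolding partial by simp
  then show ?thesis by (simp only: tendsto_of_real_iff)
qed

section \<open>The limiting proportion of leaves\<close>

lemma two_over_pi_approx: "\<bar>(1 - 2 / pi) - 0.3633802278\<bar> < 1 / 10 ^ 9"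
proof -
  \<comment> \<open>The bounds are \<open>1 - 0.3633802278\<close> minus and plus
    \<open>1 / 10 ^ 9\<close>.\<close>
  have "0.6366197712 * pi < 2" "2 < 0.6366197732 * pi"
    using pi_approx by auto
  then have "0.6366197712 < 2 / pi" "2 / pi < 0.6366197732"
    by (simp_all add: field_simps)
  then show ?thesis unfolding abs_less_iff by simp
qed

theorem theorem2p4:
  shows "((\<lambda>n. real (total_leaves n) / (real n * real (euler_number n))) \<longlonglongrightarrow> 1 - 2 / pi) \<and>
         \<bar>(1 - 2 / pi) - 0.3633802278\<bar> < 1 / 10 ^ 9"
proof (intro conjI two_over_pi_approx)
  \<comment> \<open>Dividing \<open>(n + 1) * E_n - E_(n+1)\<close> by \<open>n * E_n\<close> and
    factoring out \<open>(n + 1) / n\<close> leaves \<open>1 - E_(n+1) / ((n + 1) * E_n)\<close>;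
    the quotient of scaled values carries an extra factor \<open>pi/2\<close>.\<close>
  let ?f = "\<lambda>n. (1 + 1 / real n) * (1 - 2 / pi * (scaled_euler (Suc n) / scaled_euler n))"
  have "?f \<longlonglongrightarrow> (1 + 0) * (1 - 2 / pi * (2 / 2))"
    by (intro tendsto_intros LIMSEQ_Suc scaled_euler_tendsto lim_1_over_n) auto
  then have lim: "?f \<longlonglongrightarrow> 1 - 2 / pi" by simp
  \<comment> \<open>The positive limit shows that the Euler numbers are eventually nonzero, as the
    divisions require.\<close>
  have "\<forall>\<^sub>F n in sequentially. scaled_euler n > 0"
    using scaled_euler_tendsto by (rule order_tendstoD) simp
  then have "\<forall>\<^sub>F n in sequentially.
      ?f n = real (total_leaves n) / (real n * real (euler_number n))"
    using eventually_ge_at_top[of 1]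
  proof eventually_elim
    case (elim n)
    have E: "real (euler_number n) \<noteq> 0" using elim(1) by (intro notI) (simp add: scaled_euler_def)
    have leaves: "real (total_leaves n) = (real n + 1) * real (euler_number n) - euler_number (Suc n)"
      using arg_cong[OF total_leaves_plus_euler_number_Suc[OF elim(2)], of real]
      by (simp add: algebra_simps)
    define c where "c = (pi / 2) ^ Suc n / fact n"
    have "c \<noteq> 0" by (simp add: c_def)
    have cancel: "2 / pi * (b * (pi / 2) * c / x / (a * c)) = b / (x * a)" for a b x :: real
      using \<open>c \<noteq> 0\<close> by simp
    have "scaled_euler n = euler_number n * c"
      by (simp add: scaled_euler_def c_def)
    moreover have "scaled_euler (Suc n) = euler_number (Suc n) * (pi / 2) * c / (real n + 1)"
      by (simp add: scaled_euler_def c_def add_ac mult_ac)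
    ultimately have ratio: "2 / pi * (scaled_euler (Suc n) / scaled_euler n) =
        euler_number (Suc n) / ((real n + 1) * real (euler_number n))"
      by (simp only: cancel)
    have "(1 + 1 / x) * (1 - b / ((x + 1) * a)) = ((x + 1) * a - b) / (x * a)"
      if "x > 0" "a \<noteq> 0" for x a b :: real
    proof -
      have "x + 1 \<noteq> 0" using that by simp
      then have "1 - b / ((x + 1) * a) = ((x + 1) * a - b) / ((x + 1) * a)"
        using that by (simp add: diff_divide_distrib)
      moreover have "1 + 1 / x = (x + 1) / x" using that by (simp add: add_divide_distrib)
      ultimately show ?thesis using \<open>x + 1 \<noteq> 0\<close> by simp
    qed
    from this[of "real n"] show ?case using E elim(2) unfolding ratio leaves by simp
  qed
  with lim show "(\<lambda>n. real (total_leaves n) / (real n * real (euler_number n))) \<longlonglongrightarrow> 1 - 2 / pi"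
    by (rule Lim_transform_eventually)
qed

end
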